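(* (Workload of forward mode.) There is a constant $c$ such that for every term $P\in\lambda LL^{\mathtt p}$ and every enumeration $\theta$ of $FV(P)$, $\mathcal W(\mathcal F_\theta(P))\le c\cdot\mathcal W(P)$. If moreover $P$ is safe, then $\mathcal F_\theta(P)$ is safe too.
   Context: **Calculus $\lambda LL$.** Fix a set of function symbols $\underline f$ with arities $n\ge 1$ bounded by a fixed constant $b$, each denoting a differentiable $f:\mathbb R^n\to\mathbb R$ and coming with symbols $\underline{\partial_i f}$ (same arity) for its partial derivatives. Types: $A,B::=\mathbb R\mid A\multimap B\mid 1\mid A\otimes B\mid\top\mid A\& B\mid {!A}$. Each variable has a fixed type. Patterns: $p,q::=x\mid {!x}\mid ()\mid (p,q)\mid\langle p,q\rangle$, no variable repeated, typed by $x:A$, $!x:{!A}$ (for $x$ of type $A$), $():1$, $(p,q):A\otimes B$, $\langle p,q\rangle:A\& B$. Terms: $M,N::=x\mid {!M}\mid\lambda p.M\mid MN\mid ()\mid (M,N)\mid\langle\rangle\mid\langle M,N\rangle\mid\underline r\mid\underline f\mid\dot+\mid\dot*$ ($r\in\mathbb R$), with $\underline r:\mathbb R$, $\underline f:({!\mathbb R}\otimes\dots\otimes{!\mathbb R})\multimap{!\mathbb R}$, $\dot+:\mathbb R\&\mathbb R\multimap\mathbb R$, $\dot*:\mathbb R\multimap\mathbb R\multimap\mathbb R$, typed as in intuitionistic linear logic: $!x$ patterns can be duplicated and erased, and $\langle\rangle:\top$ and $\underline 0:\mathbb R$ are typable in any environment. **Workload.** $\mathcal W(A)$ is the number of occurrences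 of $\mathbb R$ in the type $A$ not under a $!$. On terms: $\mathcal W(\underline f)=\mathcal W(\dot+)=\mathcal W(\dot* )=1$; $\mathcal W(x)=\mathcal W(!M)=\mathcal W(())=\mathcal W(\langle\rangle)=\mathcal W(\underline r)=0$; $\mathcal W(\lambda p.M)=\mathcal W(M)+\sum_{x:A\,\in\,FV(p)\setminus FV(M)}\mathcal W(A)$; $\mathcal W(MN)=\mathcal W((M,N))=\mathcal W(\langle M,N\rangle)=\mathcal W(M)+\mathcal W(N)$. (When computing $\mathcal W(\lambda\,{!x}.M)$, the erasure of a variable bound by a pattern $!x$ has type $!A$ and contributes $0$.) **Safe term.** A variable is ground if its type contains no $\multimap$. A term $M$ is safe if (i) for every subterm $!M'$ of $M$, $\mathcal W(M')=0$; (ii) for every subterm $\langle M_1,M_2\rangle$ of $M$, $FV(M_1)\cap FV(M_2)$ contains only ground variables. **Abbreviations.** $\mathtt{let}\ p=N\ \mathtt{in}\ M:=(\lambda p.M)N$; $\S M:=\langle(),M\rangle$ for terms and patterns $M$; $M\dot+N:=\dot+\langle M,N\rangle$; $y\dot*u:=\dot*\,y\,u$. $n$-ary tuples $\langle M_1,\dots,M_n\rangle$ (terms, patterns and $\&$-types) are right-nested; the $1$-ary tuple is its component; the empty tuple is $\langle\rangle$, and the empty tuple pattern is a fresh variable of type $\top$. **Fragment $\lambda LL^{\mathtt p}$.** Well-typed terms $P,Q::={!x}\mid{!\underline r}\mid{!()}\mid\underline f(!x_1,\dots,!x_n)\mid\mathtt{let}\,{!x}=Q\,\mathtt{in}\,P$,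 where variables have types $D,E::=\mathbb R\mid1\mid{!D}\otimes{!E}$. Put $\mathsf t(\mathbb R)=\mathbb R$, $\mathsf t(1)=\top$, $\mathsf t({!D}\otimes{!E})=\mathsf t(D)\&\mathsf t(E)$. **Forward transformation $\mathcal F_\theta$**, mapping $P\in\lambda LL^{\mathtt p}$ and an enumeration $\theta$ of its free variables to a term of $\lambda LL$, by induction on $P$; write $u_\theta=\langle u_x\rangle_{x\in\theta}$ for a tuple (pattern) of fresh variables with $u_x:\mathsf t(E)$ for $x:E$: - $\mathcal F_{(x)}(!x)=(!x,\S(\lambda u.u))$; $\mathcal F_{()}(!\underline r)=(!\underline r,\S(\lambda u^\top.\underline0))$; $\mathcal F_{()}(!())=(!(),\S(\lambda u^\top.\langle\rangle))$; - $\mathcal F_\theta(\underline f(!x_1,\dots,!x_n))=\mathtt{let}\,{!y_1}=\underline{\partial_1f}(!x_1,\dots,!x_n)\,\mathtt{in}\cdots\mathtt{let}\,{!y_n}=\underline{\partial_nf}(!x_1,\dots,!x_n)\,\mathtt{in}\,(\underline f(!x_1,\dots,!x_n),\S(\lambda u_\theta.(y_1\dot*u_{x_1})\dot+\cdots\dot+(y_n\dot*u_{x_n})))$; - $\mathcal F_\theta(\mathtt{let}\,{!x}=Q\,\mathtt{in}\,P)=\mathtt{let}\,(!x,\S f)=\mathcal F_{\theta\cap FV(Q)}(Q)\,\mathtt{in}\,\mathtt{let}\,(!y,\S g)=\mathcal F_{x,\theta\cap FV(P)}(P)\,\mathtt{in}\,(!y,\S(\lambda u_\theta.\,g\,T))$,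 where $T$ is the tuple with first component $f\,u_{\theta\cap FV(Q)}$ followed by the $u_z$ for $z\in\theta\cap FV(P)$.
   Formalization: Terms containing a vacuous let (let !x = Q in P with x not free in P) are not covered: the definition of F_θ gives them no transform, since x, θ∩FV(P) does not then enumerate FV(P). *)

theory Defs
  imports "HOL-Analysis.Analysis" "HOL-Library.Multiset"
begin

section \<open>Syntax\<close>

datatype ty =
    RealT
  | Lolli ty ty
  | OneT
  | Tens ty ty
  | TopT
  | With ty ty
  | Bang ty

datatype var = V (vname: nat) (vtype: ty)

datatype pat =
    PVar var
  | PBang var
  | PUnit
  | PTens pat pat
  | PWith pat pat

datatype 'f tm =
    Var var
  | BangI "'f tm"
  | Lam pat "'f tm"
  | App "'f tm" "'f tm"
  | UnitI
  | TensI "'f tm" "'f tm"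
  | TopI
  | WithI "'f tm" "'f tm"
  | Const real
  | Fn 'f
  | AddS
  | MulS

text \<open>The variables of a pattern, each with the type at which the pattern binds it.\<close>

fun binds :: "pat \<Rightarrow> (var \<times> ty) list" where
  "binds (PVar x) = [(x, vtype x)]"
| "binds (PBang x) = [(x, Bang (vtype x))]"
| "binds PUnit = []"
| "binds (PTens p q) = binds p @ binds q"
| "binds (PWith p q) = binds p @ binds q"

definition FVp :: "pat \<Rightarrow> var set" where
  "FVp p = fst ` set (binds p)"

fun ptype :: "pat \<Rightarrow> ty" where
  "ptype (PVar x) = vtype x"
| "ptype (PBang x) = Bang (vtype x)"
| "ptype PUnit = OneT"
| "ptype (PTens p q) = Tens (ptype p) (ptype q)"
| "ptype (PWith p q) = With (ptype p) (ptype q)"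

fun FV :: "'f tm \<Rightarrow> var set" where
  "FV (Var x) = {x}"
| "FV (BangI M) = FV M"
| "FV (Lam p M) = FV M - FVp p"
| "FV (App M N) = FV M \<union> FV N"
| "FV UnitI = {}"
| "FV (TensI M N) = FV M \<union> FV N"
| "FV TopI = {}"
| "FV (WithI M N) = FV M \<union> FV N"
| "FV (Const r) = {}"
| "FV (Fn f) = {}"
| "FV AddS = {}"
| "FV MulS = {}"

fun subterms :: "'f tm \<Rightarrow> 'f tm set" where
  "subterms (Var x) = {Var x}"
| "subterms (BangI M) = insert (BangI M) (subterms M)"
| "subterms (Lam p M) = insert (Lam p M) (subterms M)"
| "subterms (App M N) = insert (App M N) (subterms M \<union> subterms N)"
| "subterms UnitI = {UnitI}"
| "subterms (TensI M N) = insert (TensI M N) (subterms M \<union> subterms N)"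
| "subterms TopI = {TopI}"
| "subterms (WithI M N) = insert (WithI M N) (subterms M \<union> subterms N)"
| "subterms (Const r) = {Const r}"
| "subterms (Fn f) = {Fn f}"
| "subterms AddS = {AddS}"
| "subterms MulS = {MulS}"

section \<open>Abbreviations and tuples\<close>

abbreviation LetI :: "pat \<Rightarrow> 'f tm \<Rightarrow> 'f tm \<Rightarrow> 'f tm" where
  "LetI p N M \<equiv> App (Lam p M) N"

abbreviation Sec :: "'f tm \<Rightarrow> 'f tm" where
  "Sec M \<equiv> WithI UnitI M"

abbreviation PSec :: "pat \<Rightarrow> pat" where
  "PSec p \<equiv> PWith PUnit p"

abbreviation Add :: "'f tm \<Rightarrow> 'f tm \<Rightarrow> 'f tm" where
  "Add M N \<equiv> App AddS (WithI M N)"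

abbreviation Mul :: "'f tm \<Rightarrow> 'f tm \<Rightarrow> 'f tm" where
  "Mul M N \<equiv> App (App MulS M) N"

fun with_ty :: "ty list \<Rightarrow> ty" where
  "with_ty [] = TopT"
| "with_ty [A] = A"
| "with_ty (A # B # As) = With A (with_ty (B # As))"

fun with_tm :: "'f tm list \<Rightarrow> 'f tm" where
  "with_tm [] = TopI"
| "with_tm [M] = M"
| "with_tm (M # N # Ms) = WithI M (with_tm (N # Ms))"

text \<open>The first argument is the variable (fresh, of type \<open>TopT\<close>) that serves as the empty
  tuple pattern; it is ignored for nonempty tuples.\<close>

fun with_pat :: "var \<Rightarrow> var list \<Rightarrow> pat" where
  "with_pat w [] = PVar w"
| "with_pat w [x] = PVar x"
| "with_pat w (x # y # xs) = PWith (PVar x) (with_pat w (y # xs))"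

text \<open>Tensor tuples and sums are used for nonempty lists only.\<close>

fun tens_ty :: "ty list \<Rightarrow> ty" where
  "tens_ty [] = OneT"
| "tens_ty [A] = A"
| "tens_ty (A # B # As) = Tens A (tens_ty (B # As))"

fun tens_tm :: "'f tm list \<Rightarrow> 'f tm" where
  "tens_tm [] = UnitI"
| "tens_tm [M] = M"
| "tens_tm (M # N # Ms) = TensI M (tens_tm (N # Ms))"

definition sum_tm :: "'f tm list \<Rightarrow> 'f tm" where
  "sum_tm Ms = foldl Add (hd Ms) (tl Ms)"

section \<open>Function symbols\<close>

text \<open>Arguments and partial derivatives are indexed from 0; points of \<open>\<real>\<^sup>n\<close> are real lists of
  length \<open>n\<close>, and the values on lists of other lengths are irrelevant.\<close>

record 'f sig =
  arity :: "'f \<Rightarrow> nat"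
  pd :: "'f \<Rightarrow> nat \<Rightarrow> 'f"
  den :: "'f \<Rightarrow> real list \<Rightarrow> real"

definition differentiable_Rn :: "nat \<Rightarrow> (real list \<Rightarrow> real) \<Rightarrow> bool" where
  "differentiable_Rn n g \<longleftrightarrow>
    (\<forall>x. length x = n \<longrightarrow>
      (\<exists>a :: nat \<Rightarrow> real. \<forall>e>0. \<exists>d>0. \<forall>y.
        length y = n \<longrightarrow> L2_set (\<lambda>i. y ! i - x ! i) {..<n} < d \<longrightarrow>
        \<bar>g y - g x - (\<Sum>i<n. a i * (y ! i - x ! i))\<bar>
          \<le> e * L2_set (\<lambda>i. y ! i - x ! i) {..<n}))"

definition signature :: "'f sig \<Rightarrow> nat \<Rightarrow> bool" where
  "signature S b \<longleftrightarrow>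
    (\<forall>f. 1 \<le> arity S f \<and> arity S f \<le> b \<and>
         differentiable_Rn (arity S f) (den S f) \<and>
         (\<forall>i < arity S f. arity S (pd S f i) = arity S f \<and>
            (\<forall>x. length x = arity S f \<longrightarrow>
              ((\<lambda>t. den S f (x[i := t])) has_real_derivative den S (pd S f i) x) (at (x ! i)))))"

section \<open>Typing\<close>

text \<open>Environments are multisets of patterns in which no variable is repeated. The
  exponential patterns \<open>!x\<close> may be weakened and are shared between the premises of the
  multiplicative rules. A compound pattern in an environment is decomposed by the left rules;
  in particular a pattern for an additive conjunction offers a choice of one component.
  The side conditions leave shadowing possible: a variable \<open>!x\<close> of the environment can be
  weakened before \<open>x\<close> is bound again.\<close>

definition wf_env :: "pat multiset \<Rightarrow> bool" where
  "wf_env \<Gamma> \<longleftrightarrow> (\<forall>x. count (\<Sum>p\<in>#\<Gamma>. mset (map fst (binds p))) x \<le> 1)"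

definition bang_env :: "pat multiset \<Rightarrow> bool" where
  "bang_env \<Gamma> \<longleftrightarrow> (\<forall>p\<in>#\<Gamma>. \<exists>x. p = PBang x)"

inductive typing :: "'f sig \<Rightarrow> pat multiset \<Rightarrow> 'f tm \<Rightarrow> ty \<Rightarrow> bool" for S where
  ty_var: "typing S {#PVar x#} (Var x) (vtype x)"
| ty_der: "typing S (add_mset (PVar x) \<Gamma>) M B \<Longrightarrow> typing S (add_mset (PBang x) \<Gamma>) M B"
| ty_weak: "typing S \<Gamma> M B \<Longrightarrow> wf_env (add_mset (PBang x) \<Gamma>) \<Longrightarrow>
    typing S (add_mset (PBang x) \<Gamma>) M B"
| ty_unitL: "typing S \<Gamma> M B \<Longrightarrow> typing S (add_mset PUnit \<Gamma>) M B"
| ty_tensL: "typing S (add_mset p (add_mset q \<Gamma>)) M B \<Longrightarrow>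
    typing S (add_mset (PTens p q) \<Gamma>) M B"
| ty_withL1: "typing S (add_mset p \<Gamma>) M B \<Longrightarrow> wf_env (add_mset (PWith p q) \<Gamma>) \<Longrightarrow>
    typing S (add_mset (PWith p q) \<Gamma>) M B"
| ty_withL2: "typing S (add_mset q \<Gamma>) M B \<Longrightarrow> wf_env (add_mset (PWith p q) \<Gamma>) \<Longrightarrow>
    typing S (add_mset (PWith p q) \<Gamma>) M B"
| ty_bang: "typing S \<Gamma> M A \<Longrightarrow> bang_env \<Gamma> \<Longrightarrow> typing S \<Gamma> (BangI M) (Bang A)"
| ty_lam: "typing S (add_mset p \<Gamma>) M B \<Longrightarrow> typing S \<Gamma> (Lam p M) (Lolli (ptype p) B)"
| ty_app: "typing S (\<Delta> + \<Gamma>) M (Lolli A B) \<Longrightarrow> typing S (\<Delta> + \<Gamma>') N A \<Longrightarrow>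
    bang_env \<Delta> \<Longrightarrow> wf_env (\<Delta> + \<Gamma> + \<Gamma>') \<Longrightarrow> typing S (\<Delta> + \<Gamma> + \<Gamma>') (App M N) B"
| ty_unit: "typing S {#} UnitI OneT"
| ty_tens: "typing S (\<Delta> + \<Gamma>) M A \<Longrightarrow> typing S (\<Delta> + \<Gamma>') N B \<Longrightarrow>
    bang_env \<Delta> \<Longrightarrow> wf_env (\<Delta> + \<Gamma> + \<Gamma>') \<Longrightarrow>
    typing S (\<Delta> + \<Gamma> + \<Gamma>') (TensI M N) (Tens A B)"
| ty_top: "wf_env \<Gamma> \<Longrightarrow> typing S \<Gamma> TopI TopT"
| ty_with: "typing S \<Gamma> M A \<Longrightarrow> typing S \<Gamma> N B \<Longrightarrow> typing S \<Gamma> (WithI M N) (With A B)"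
| ty_const: "typing S {#} (Const r) RealT"
| ty_zero: "wf_env \<Gamma> \<Longrightarrow> typing S \<Gamma> (Const 0) RealT"
| ty_fn: "typing S {#} (Fn f)
    (Lolli (tens_ty (replicate (arity S f) (Bang RealT))) (Bang RealT))"
| ty_add: "typing S {#} AddS (Lolli (With RealT RealT) RealT)"
| ty_mul: "typing S {#} MulS (Lolli RealT (Lolli RealT RealT))"

text \<open>Terms are in Church style, so the type of a typable term can be read off the term
  (outside the typable terms this function is meaningless).\<close>

fun type_of :: "'f sig \<Rightarrow> 'f tm \<Rightarrow> ty" where
  "type_of S (Var x) = vtype x"
| "type_of S (BangI M) = Bang (type_of S M)"
| "type_of S (Lam p M) = Lolli (ptype p) (type_of S M)"
| "type_of S (App M N) = (case type_of S M of Lolli A B \<Rightarrow> B | _ \<Rightarrow> undefined)"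
| "type_of S UnitI = OneT"
| "type_of S (TensI M N) = Tens (type_of S M) (type_of S N)"
| "type_of S TopI = TopT"
| "type_of S (WithI M N) = With (type_of S M) (type_of S N)"
| "type_of S (Const r) = RealT"
| "type_of S (Fn f) = Lolli (tens_ty (replicate (arity S f) (Bang RealT))) (Bang RealT)"
| "type_of S AddS = Lolli (With RealT RealT) RealT"
| "type_of S MulS = Lolli RealT (Lolli RealT RealT)"

lemma typing_type_of: "typing S \<Gamma> M A \<Longrightarrow> type_of S M = A"
  by (induction rule: typing.induct) simp_all

section \<open>Workload and safety\<close>

fun wl_ty :: "ty \<Rightarrow> nat" where
  "wl_ty RealT = 1"
| "wl_ty (Lolli A B) = wl_ty A + wl_ty B"
| "wl_ty OneT = 0"
| "wl_ty (Tens A B) = wl_ty A + wl_ty B"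
| "wl_ty TopT = 0"
| "wl_ty (With A B) = wl_ty A + wl_ty B"
| "wl_ty (Bang A) = 0"

fun wl :: "'f tm \<Rightarrow> nat" where
  "wl (Var x) = 0"
| "wl (BangI M) = 0"
| "wl (Lam p M) = wl M + (\<Sum>(x, A) \<in> {(x, A) \<in> set (binds p). x \<notin> FV M}. wl_ty A)"
| "wl (App M N) = wl M + wl N"
| "wl UnitI = 0"
| "wl (TensI M N) = wl M + wl N"
| "wl TopI = 0"
| "wl (WithI M N) = wl M + wl N"
| "wl (Const r) = 0"
| "wl (Fn f) = 1"
| "wl AddS = 1"
| "wl MulS = 1"

fun ground_ty :: "ty \<Rightarrow> bool" where
  "ground_ty RealT = True"
| "ground_ty (Lolli A B) = False"
| "ground_ty OneT = True"
| "ground_ty (Tens A B) = (ground_ty A \<and> ground_ty B)"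
| "ground_ty TopT = True"
| "ground_ty (With A B) = (ground_ty A \<and> ground_ty B)"
| "ground_ty (Bang A) = ground_ty A"

definition safe :: "'f tm \<Rightarrow> bool" where
  "safe M \<longleftrightarrow>
    (\<forall>M'. BangI M' \<in> subterms M \<longrightarrow> wl M' = 0) \<and>
    (\<forall>M\<^sub>1 M\<^sub>2. WithI M\<^sub>1 M\<^sub>2 \<in> subterms M \<longrightarrow>
      (\<forall>x \<in> FV M\<^sub>1 \<inter> FV M\<^sub>2. ground_ty (vtype x)))"

section \<open>The primal fragment\<close>

inductive prim_ty :: "ty \<Rightarrow> bool" where
  "prim_ty RealT"
| "prim_ty OneT"
| "prim_ty D \<Longrightarrow> prim_ty E \<Longrightarrow> prim_ty (Tens (Bang D) (Bang E))"

fun tan_ty :: "ty \<Rightarrow> ty" where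
  "tan_ty RealT = RealT"
| "tan_ty OneT = TopT"
| "tan_ty (Tens (Bang D) (Bang E)) = With (tan_ty D) (tan_ty E)"
| "tan_ty _ = undefined"

abbreviation fn_call :: "'f \<Rightarrow> var list \<Rightarrow> 'f tm" where
  "fn_call f xs \<equiv> App (Fn f) (tens_tm (map (\<lambda>x. BangI (Var x)) xs))"

inductive prim_tm :: "'f sig \<Rightarrow> 'f tm \<Rightarrow> bool" for S where
  pt_var: "prim_ty (vtype x) \<Longrightarrow> prim_tm S (BangI (Var x))"
| pt_const: "prim_tm S (BangI (Const r))"
| pt_unit: "prim_tm S (BangI UnitI)"
| pt_fn: "length xs = arity S f \<Longrightarrow> \<forall>x \<in> set xs. prim_ty (vtype x) \<Longrightarrow> prim_tm S (fn_call f xs)"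
| pt_let: "prim_ty (vtype x) \<Longrightarrow> prim_tm S Q \<Longrightarrow> prim_tm S P \<Longrightarrow>
    prim_tm S (LetI (PBang x) Q P)"

definition lamLLp :: "'f sig \<Rightarrow> 'f tm set" where
  "lamLLp S = {P. prim_tm S P \<and> (\<exists>\<Gamma> A. typing S \<Gamma> P A)}"

definition enumerates :: "var list \<Rightarrow> 'f tm \<Rightarrow> bool" where
  "enumerates \<theta> M \<longleftrightarrow> distinct \<theta> \<and> set \<theta> = FV M"

section \<open>Forward transformation\<close>

text \<open>\<open>forward S \<theta> P M\<close> means that \<open>M\<close> is the forward transform of \<open>P\<close> with respect to \<open>\<theta>\<close>,
  for some admissible choice of the fresh variables; \<open>u\<close> sends each variable of \<open>\<theta>\<close> to its
  fresh tangent variable.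

  Terms are not identified up to alpha-equivalence. In \<open>let !x = Q in P\<close> the variable \<open>x\<close> may
  therefore also occur free in \<open>Q\<close>, hence in \<open>\<theta>\<close>. That occurrence is not the one bound
  in \<open>P\<close>, so it is removed from the variables that \<open>P\<close> inherits from \<open>\<theta>\<close>; if bound variables
  are distinct from free ones, \<open>\<theta>\<^sub>P\<close> is just the restriction of \<open>\<theta>\<close> to the free variables
  of \<open>P\<close>.

  In the let case the index \<open>x # \<theta>\<^sub>P\<close> of the recursive call enumerates the free variables
  of \<open>P\<close> only if \<open>x\<close> occurs free in \<open>P\<close>, so terms with a vacuous let have no transform.\<close>

inductive forward :: "'f sig \<Rightarrow> var list \<Rightarrow> 'f tm \<Rightarrow> 'f tm \<Rightarrow> bool" for S where
  fw_var:
  "vtype u = tan_ty (vtype x) \<Longrightarrow> u \<noteq> x \<Longrightarrow>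
    forward S [x] (BangI (Var x)) (TensI (BangI (Var x)) (Sec (Lam (PVar u) (Var u))))"
| fw_const:
  "vtype u = TopT \<Longrightarrow>
    forward S [] (BangI (Const r)) (TensI (BangI (Const r)) (Sec (Lam (PVar u) (Const 0))))"
| fw_unit:
  "vtype u = TopT \<Longrightarrow>
    forward S [] (BangI UnitI) (TensI (BangI UnitI) (Sec (Lam (PVar u) TopI)))"
| fw_fn:
  "length xs = arity S f \<Longrightarrow> enumerates \<theta> (fn_call f xs :: 'f tm) \<Longrightarrow>
    length ys = arity S f \<Longrightarrow> \<forall>y \<in> set ys. vtype y = RealT \<Longrightarrow>
    \<forall>z \<in> set \<theta>. vtype (u z) = tan_ty (vtype z) \<Longrightarrow> vtype w = TopT \<Longrightarrow>
    distinct (w # ys @ map u \<theta>) \<Longrightarrow> set (w # ys @ map u \<theta>) \<inter> set xs = {} \<Longrightarrow>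
    forward S \<theta> (fn_call f xs)
      (foldr (\<lambda>i M. LetI (PBang (ys ! i)) (fn_call (pd S f i) xs) M) [0..<arity S f]
        (TensI (fn_call f xs)
          (Sec (Lam (with_pat w (map u \<theta>))
            (sum_tm (map (\<lambda>i. Mul (Var (ys ! i)) (Var (u (xs ! i)))) [0..<arity S f]))))))"
| fw_let:
  "enumerates \<theta> (LetI (PBang x) Q P) \<Longrightarrow>
    \<theta>\<^sub>Q = filter (\<lambda>z. z \<in> FV Q) \<theta> \<Longrightarrow> \<theta>\<^sub>P = filter (\<lambda>z. z \<in> FV P - {x}) \<theta> \<Longrightarrow>
    forward S \<theta>\<^sub>Q Q Q' \<Longrightarrow> forward S (x # \<theta>\<^sub>P) P P' \<Longrightarrow>
    type_of S Q = Bang D \<Longrightarrow> type_of S P = Bang E \<Longrightarrow> vtype y = E \<Longrightarrow>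
    vtype f = Lolli (with_ty (map (\<lambda>z. tan_ty (vtype z)) \<theta>\<^sub>Q)) (tan_ty D) \<Longrightarrow>
    vtype g = Lolli (with_ty (map (\<lambda>z. tan_ty (vtype z)) (x # \<theta>\<^sub>P))) (tan_ty E) \<Longrightarrow>
    \<forall>z \<in> set \<theta>. vtype (u z) = tan_ty (vtype z) \<Longrightarrow> vtype w = TopT \<Longrightarrow>
    distinct (w # y # f # g # map u \<theta>) \<Longrightarrow>
    set (w # y # f # g # map u \<theta>) \<inter> insert x (FV Q \<union> FV P) = {} \<Longrightarrow>
    forward S \<theta> (LetI (PBang x) Q P)
      (LetI (PTens (PBang x) (PSec (PVar f))) Q'
        (LetI (PTens (PBang y) (PSec (PVar g))) P'
          (TensI (BangI (Var y))
            (Sec (Lam (with_pat w (map u \<theta>))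
              (App (Var g)
                (with_tm (App (Var f) (with_tm (map (\<lambda>z. Var (u z)) \<theta>\<^sub>Q))
                  # map (\<lambda>z. Var (u z)) \<theta>\<^sub>P))))))))"

lemma FV_tens_tm: "FV (tens_tm Ms) = (\<Union>M \<in> set Ms. FV M)"
  by (induction Ms rule: tens_tm.induct) auto

lemma forward_enumerates: "forward S \<theta> P M \<Longrightarrow> enumerates \<theta> P"
  by (induction rule: forward.induct) (auto simp: enumerates_def)

lemma finite_FV: "finite (FV M)"
  by (induction M) auto

lemma fresh_vars:
  assumes "finite A"
  shows "\<exists>vs. map vtype vs = Ts \<and> distinct vs \<and> set vs \<inter> A = {}"
proof (induction Ts)
  case Nil
  then show ?case by auto
next
  case (Cons T Ts)
  then obtain vs where vs: "map vtype vs = Ts" "distinct vs" "set vs \<inter> A = {}" by blast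
  have "inj (\<lambda>n. V n T)" by (auto simp: inj_def)
  then have "infinite (range (\<lambda>n. V n T))" by (simp add: finite_image_iff)
  moreover have "finite (A \<union> set vs)" using assms by simp
  ultimately obtain n where "V n T \<notin> A \<union> set vs"
    by (meson finite_subset image_subsetI)
  with vs show ?case by (intro exI[of _ "V n T # vs"]) simp
qed

lemma fresh_tangents:
  assumes "finite A" "distinct \<theta>"
  shows "\<exists>vs u. map vtype vs = Ts \<and> (\<forall>z \<in> set \<theta>. vtype (u z) = tan_ty (vtype z)) \<and>
    distinct (vs @ map u \<theta>) \<and> set (vs @ map u \<theta>) \<inter> A = {}"
proof -
  obtain us where us: "map vtype us = Ts @ map (\<lambda>z. tan_ty (vtype z)) \<theta>" "distinct us"
      "set us \<inter> A = {}"
    using fresh_vars[OF assms(1)] by blast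
  define vs ws where "vs = take (length Ts) us" and "ws = drop (length Ts) us"
  have vw: "us = vs @ ws" "map vtype vs = Ts" "map vtype ws = map (\<lambda>z. tan_ty (vtype z)) \<theta>"
    unfolding vs_def ws_def using us(1) by (simp_all flip: take_map drop_map)
  have len: "length ws = length \<theta>" using vw(3) by (metis length_map)
  define u where "u z = the (map_of (zip \<theta> ws) z)" for z
  have nth: "u (\<theta> ! i) = ws ! i" if "i < length \<theta>" for i
    using that len assms(2) by (simp add: u_def map_of_zip_nth)
  have m: "map u \<theta> = ws" using len nth by (auto intro: nth_equalityI)
  then have "map (\<lambda>z. vtype (u z)) \<theta> = map (\<lambda>z. tan_ty (vtype z)) \<theta>"
    using vw(3) by (metis (no_types, lifting) map_map comp_apply map_eq_conv)
  then have "\<forall>z \<in> set \<theta>. vtype (u z) = tan_ty (vtype z)" by simp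
  with m vw us show ?thesis by metis
qed

lemma prim_tm_type: "prim_tm S P \<Longrightarrow> \<exists>D. type_of S P = Bang D"
  by (induction rule: prim_tm.induct) auto

text \<open>The transform exists exactly for the terms of the fragment without vacuous lets.\<close>

lemma forward_total:
  assumes "prim_tm S P" "enumerates \<theta> P"
    and "\<And>x Q N. LetI (PBang x) Q N \<in> subterms P \<Longrightarrow> x \<in> FV N"
  shows "\<exists>M. forward S \<theta> P M"
  using assms
proof (induction arbitrary: \<theta> rule: prim_tm.induct)
  case (pt_var x)
  then have "distinct \<theta>" "set \<theta> = {x}" by (auto simp: enumerates_def)
  then have "\<theta> = [x]" by (metis distinct.simps(2) list.set_intros(2) neq_Nil_conv
    set_ConsD singletonD singletonI list.set_intros(1) empty_iff empty_set)
  moreover obtain u where "vtype u = tan_ty (vtype x)" "u \<noteq> x"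
    using fresh_vars[of "{x}" "[tan_ty (vtype x)]"] by auto
  ultimately show ?case using fw_var by blast
next
  case (pt_const r)
  then show ?case using fw_const[of "V 0 TopT"] by (auto simp: enumerates_def)
next
  case pt_unit
  then show ?case using fw_unit[of "V 0 TopT"] by (auto simp: enumerates_def)
next
  case (pt_fn xs f)
  have d: "distinct \<theta>" using pt_fn by (simp add: enumerates_def)
  obtain vs u where vu: "map vtype vs = TopT # replicate (arity S f) RealT"
      "\<forall>z \<in> set \<theta>. vtype (u z) = tan_ty (vtype z)"
      "distinct (vs @ map u \<theta>)" "set (vs @ map u \<theta>) \<inter> set xs = {}"
    using fresh_tangents[OF finite_set d] by blast
  then obtain w ys where wy: "vs = w # ys" "vtype w = TopT"
      "map vtype ys = replicate (arity S f) RealT" by auto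
  then have l: "length ys = arity S f" by (metis length_map length_replicate)
  have y: "\<forall>y \<in> set ys. vtype y = RealT"
    using wy(3) by (metis image_eqI in_set_replicate list.set_map)
  have dist: "distinct (w # ys @ map u \<theta>)" "set (w # ys @ map u \<theta>) \<inter> set xs = {}"
    using vu(3,4) wy(1) by simp_all
  from fw_fn[OF pt_fn(1) pt_fn(3) l y vu(2) wy(2) dist] show ?case by blast
next
  case (pt_let x Q P)
  let ?Q = "filter (\<lambda>z. z \<in> FV Q) \<theta>" and ?P = "filter (\<lambda>z. z \<in> FV P - {x}) \<theta>"
  have d: "distinct \<theta>" using pt_let by (simp add: enumerates_def)
  have x: "x \<in> FV P" using pt_let(7)[of x P Q] by simp
  have en: "enumerates ?Q Q" "enumerates (x # ?P) P"
    using pt_let(6) x by (auto simp: enumerates_def FVp_def)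
  have sub: "z \<in> FV N" if "LetI (PBang z) N' N \<in> subterms Q \<union> subterms P" for z N' N
    using that pt_let(7)[of z N N'] by auto
  have "\<exists>M. forward S ?Q Q M"
    by (rule pt_let(4)[OF en(1)]) (rule sub, blast)
  moreover have "\<exists>M. forward S (x # ?P) P M"
    by (rule pt_let(5)[OF en(2)]) (rule sub, blast)
  ultimately obtain Q' P' where QP: "forward S ?Q Q Q'" "forward S (x # ?P) P P'"
    by blast
  obtain D E where DE: "type_of S Q = Bang D" "type_of S P = Bang E"
    using prim_tm_type[OF pt_let(2)] prim_tm_type[OF pt_let(3)] by blast
  have fin: "finite (insert x (FV Q \<union> FV P))" by (simp add: finite_FV)
  define F G where "F = Lolli (with_ty (map (\<lambda>z. tan_ty (vtype z)) ?Q)) (tan_ty D)"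
    and "G = Lolli (with_ty (map (\<lambda>z. tan_ty (vtype z)) (x # ?P))) (tan_ty E)"
  obtain vs u where vu: "map vtype vs = [TopT, E, F, G]"
      "\<forall>z \<in> set \<theta>. vtype (u z) = tan_ty (vtype z)"
      "distinct (vs @ map u \<theta>)" "set (vs @ map u \<theta>) \<inter> insert x (FV Q \<union> FV P) = {}"
    using fresh_tangents[OF fin d, of "[TopT, E, F, G]"] by (elim exE conjE)
  have "length vs = 4" using arg_cong[OF vu(1), of length] by simp
  then obtain w y f g where vs: "vs = [w, y, f, g]"
    by (auto simp: length_Suc_conv numeral_eq_Suc)
  with vu(1) have v: "vtype w = TopT" "vtype y = E" "vtype f = F" "vtype g = G" by simp_all
  have dist: "distinct (w # y # f # g # map u \<theta>)"
    "set (w # y # f # g # map u \<theta>) \<inter> insert x (FV Q \<union> FV P) = {}"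
    using vu(3,4) vs by simp_all
  from fw_let[OF pt_let(6) refl refl QP DE v(2) v(3)[unfolded F_def] v(4)[unfolded G_def]
      vu(2) v(1) dist]
  show ?case by (rule exI)
qed

lemma forward_not_vacuous:
  assumes "forward S \<theta> P M" "LetI (PBang x) Q N \<in> subterms P"
  shows "x \<in> FV N"
proof -
  have "L \<notin> subterms (tens_tm Ms)"
    if "L = LetI (PBang x) Q N" "\<forall>M \<in> set Ms. L \<notin> subterms M" for L and Ms :: "'a tm list"
    using that by (induction Ms rule: tens_tm.induct) auto
  then have no: "LetI (PBang x) Q N \<notin> subterms (tens_tm (map (\<lambda>x. BangI (Var x)) xs))" for xs
    by simp
  show ?thesis using assms
  proof (induction rule: forward.induct)
    case (fw_let \<theta> y Q' P' \<theta>\<^sub>Q \<theta>\<^sub>P)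
    have "y \<in> FV P'"
      using forward_enumerates[OF fw_let(5)] unfolding enumerates_def by auto
    moreover from fw_let.prems have "LetI (PBang x) Q N = LetI (PBang y) Q' P' \<or>
        LetI (PBang x) Q N \<in> subterms Q' \<or> LetI (PBang x) Q N \<in> subterms P'"
      by auto
    ultimately show ?case using fw_let.IH by blast
  next
    case (fw_fn xs f)
    from fw_fn.prems no[of xs] show ?case by simp
  qed simp_all
qed

end

theory Submission
  imports Defs
begin

text \<open>The transform of a function call \<open>f(!x\<^sub>1,\<dots>,!x\<^sub>n)\<close>, whose workload is 1, consists of
  \<open>n + 1\<close> calls, \<open>n\<close> products and \<open>n - 1\<close> sums, so it has workload
  \<open>3n \<le> 3b\<close>. On lets the transform adds nothing to the workloads of the two parts, because every
  variable that it binds is used, exponential, or of type \<open>TopT\<close>. Hence \<open>c = 3b\<close> works.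
  The only variables that additive pairs share in a transform are tangents
  of primal variables and reals, and these are ground.\<close>

text \<open>This bypasses the erasure sum of \<open>wl\<close> on abstractions; every binder of a
  let transform and every tangent tuple is treated through it.\<close>

lemma wl_Lam_unerased:
  assumes "\<And>x A. (x, A) \<in> set (binds p) \<Longrightarrow> x \<notin> FV M \<Longrightarrow> wl_ty A = 0"
  shows "wl (Lam p M) = wl M"
  using assms by (auto intro!: sum.neutral)

lemma wl_Lam_PBang: "wl (Lam (PBang x) M) = wl M"
  by (intro wl_Lam_unerased) auto

lemma set_binds_with_pat:
  "set (binds (with_pat w xs)) =
    (if xs = [] then {(w, vtype w)} else (\<lambda>x. (x, vtype x)) ` set xs)"
  by (induction w xs rule: with_pat.induct) auto

lemma FVp_with_pat: "FVp (with_pat w xs) = (if xs = [] then {w} else set xs)"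
  by (auto simp: FVp_def set_binds_with_pat image_image)

text \<open>If \<open>xs\<close> is empty, the only bound variable is \<open>w\<close>, whose type
  has workload 0.\<close>

lemma wl_Lam_with_pat:
  assumes "vtype w = TopT" "set xs \<subseteq> FV M"
  shows "wl (Lam (with_pat w xs) M) = wl M"
  using assms by (intro wl_Lam_unerased) (auto simp: set_binds_with_pat split: if_splits)

lemma FV_with_tm: "FV (with_tm Ms) = (\<Union>M \<in> set Ms. FV M)"
  by (induction Ms rule: with_tm.induct) auto

lemma wl_with_tm: "wl (with_tm Ms) = sum_list (map wl Ms)"
  by (induction Ms rule: with_tm.induct) auto

lemma wl_tens_tm: "wl (tens_tm Ms) = sum_list (map wl Ms)"
  by (induction Ms rule: tens_tm.induct) auto

lemma wl_fn_call: "wl (fn_call f xs) = 1"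
  by (simp add: wl_tens_tm comp_def)

lemma FV_fn_call: "FV (fn_call f xs) = set xs"
  by (auto simp: FV_tens_tm)

lemma FV_sum_tm: "Ms \<noteq> [] \<Longrightarrow> FV (sum_tm Ms) = (\<Union>M \<in> set Ms. FV M)"
proof -
  have "FV (foldl Add M Ns) = FV M \<union> (\<Union>N \<in> set Ns. FV N)" for M :: "'a tm" and Ns
    by (induction Ns arbitrary: M) auto
  then show "Ms \<noteq> [] \<Longrightarrow> ?thesis" by (cases Ms) (auto simp: sum_tm_def)
qed

lemma wl_sum_tm: "Ms \<noteq> [] \<Longrightarrow> wl (sum_tm Ms) = sum_list (map wl Ms) + (length Ms - 1)"
proof -
  have "wl (foldl Add M Ns) = wl M + sum_list (map wl Ns) + length Ns" for M :: "'a tm" and Ns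
    by (induction Ns arbitrary: M) auto
  then show "Ms \<noteq> [] \<Longrightarrow> ?thesis" by (cases Ms) (auto simp: sum_tm_def)
qed

lemma wl_foldr_LetI_PBang:
  "wl (foldr (\<lambda>i. LetI (PBang (y i)) (N i)) is M) = (\<Sum>i\<leftarrow>is. wl (N i)) + wl M"
by (induction "is") (simp_all add: wl_Lam_PBang del: wl.simps(3))

text \<open>Recasts the quantification over subterms as structural recursion, so that simplification
  can decompose safety.\<close>

lemma safe_simps [simp]:
  "safe (Var x)" "safe UnitI" "safe TopI" "safe (Const r)" "safe (Fn f)" "safe AddS" "safe MulS"
  "safe (BangI M) \<longleftrightarrow> wl M = 0 \<and> safe M"
  "safe (Lam p M) \<longleftrightarrow> safe M"
  "safe (App M N) \<longleftrightarrow> safe M \<and> safe N"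
  "safe (TensI M N) \<longleftrightarrow> safe M \<and> safe N"
  "safe (WithI M N) \<longleftrightarrow> (\<forall>x \<in> FV M \<inter> FV N. ground_ty (vtype x)) \<and> safe M \<and> safe N"
  by (auto simp: safe_def)

lemma safe_tens_tm: "safe (tens_tm Ms) \<longleftrightarrow> (\<forall>M \<in> set Ms. safe M)"
  by (induction Ms rule: tens_tm.induct) auto

text \<open>Tuples nest to the right, so a variable shared by two sides of a pair always occurs in a
  component after the first. The first one may thus contain non-ground variables.\<close>

lemma safe_with_tm:
  assumes "\<forall>M \<in> set Ms. safe M" "\<forall>M \<in> set (tl Ms). \<forall>x \<in> FV M. ground_ty (vtype x)"
  shows "safe (with_tm Ms)"
  using assms by (induction Ms rule: with_tm.induct) (auto simp: FV_with_tm)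

lemma safe_sum_tm:
  assumes "Ms \<noteq> []" "\<forall>M \<in> set Ms. safe M" "\<forall>M \<in> set Ms. \<forall>x \<in> FV M. ground_ty (vtype x)"
  shows "safe (sum_tm Ms)"
proof -
  have "safe (foldl Add M Ns)"
    if "safe M" "\<forall>N \<in> set Ns. safe N \<and> (\<forall>x \<in> FV N. ground_ty (vtype x))"
    for M :: "'a tm" and Ns
    using that by (induction Ns arbitrary: M) auto
  then show ?thesis using assms by (cases Ms) (auto simp: sum_tm_def)
qed

lemma safe_foldr_LetI:
  assumes "\<forall>i \<in> set is. safe (N i)" "safe M"
  shows "safe (foldr (\<lambda>i. LetI (p i) (N i)) is M)"
  using assms by (induction "is") auto

text \<open>Tangent types of primal types are built from \<open>RealT\<close>, \<open>TopT\<close>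
  and \<open>With\<close> alone.\<close>

lemma ground_tan_ty: "prim_ty D \<Longrightarrow> ground_ty (tan_ty D)"
  by (induction rule: prim_ty.induct) auto

lemma prim_tm_FV: "prim_tm S P \<Longrightarrow> x \<in> FV P \<Longrightarrow> prim_ty (vtype x)"
proof (induction rule: prim_tm.induct)
  case (pt_fn xs f)
  then show ?case by (simp only: FV_fn_call)
qed auto

lemma prim_tm_LetI: "prim_tm S (LetI (PBang x) Q P) \<Longrightarrow> prim_tm S Q \<and> prim_tm S P"
  by (auto elim: prim_tm.cases)

lemma wl_forward:
  assumes "forward S \<theta> P M" and "signature S b"
  shows "wl M \<le> 3 * b * wl P"
  using assms(1)
proof (induction rule: forward.induct)
  case (fw_fn xs f \<theta> ys u w)
  let ?muls = "map (\<lambda>i. Mul (Var (ys ! i)) (Var (u (xs ! i)))) [0..<arity S f] :: 'a tm list"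
  have n: "1 \<le> arity S f" "arity S f \<le> b" using assms(2) by (auto simp: signature_def)
  \<comment> \<open>Every tangent occurs in some product, so the tuple pattern erases nothing of
    positive workload.\<close>
  have "set \<theta> = set xs" using fw_fn.hyps by (metis enumerates_def FV_fn_call)
  also have "\<dots> = (\<lambda>i. xs ! i) ` {0..<arity S f}"
    using fw_fn.hyps by (auto simp: set_conv_nth)
  finally have "set (map u \<theta>) \<subseteq> FV (sum_tm ?muls)"
    using n by (auto simp: FV_sum_tm)
  then have "wl (Lam (with_pat w (map u \<theta>)) (sum_tm ?muls)) = wl (sum_tm ?muls)"
    using fw_fn.hyps by (intro wl_Lam_with_pat)
  also have "\<dots> = arity S f + (arity S f - 1)"
    using n by (simp add: wl_sum_tm comp_def sum_list_triv)
  \<comment> \<open>With n the arity, the total is n + 1 + n + (n - 1) = 3n; the natural subtraction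
    is exact because n is at least 1.\<close>
  finally show ?case
    unfolding wl_foldr_LetI_PBang wl_fn_call using n
    by (simp add: wl_tens_tm comp_def sum_list_triv del: wl.simps(3))
next
  case (fw_let \<theta> x Q P \<theta>\<^sub>Q \<theta>\<^sub>P Q' P' D E y f g u w)
  let ?T = "with_tm (App (Var f) (with_tm (map (\<lambda>z. Var (u z)) \<theta>\<^sub>Q))
    # map (\<lambda>z. Var (u z)) \<theta>\<^sub>P) :: 'a tm"
  let ?J = "Lam (with_pat w (map u \<theta>)) (App (Var g) ?T) :: 'a tm"
  let ?N = "Lam (PTens (PBang y) (PSec (PVar g))) (TensI (BangI (Var y)) (Sec ?J)) :: 'a tm"
  have T: "FV ?T = insert f (u ` (set \<theta>\<^sub>Q \<union> set \<theta>\<^sub>P))" "wl ?T = 0"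
    by (auto simp: FV_with_tm wl_with_tm comp_def)
  \<comment> \<open>A free variable of the let lies in \<open>Q\<close>, or in \<open>P\<close> and
    differs from \<open>x\<close>, so its tangent is passed to \<open>f\<close> or to
    \<open>g\<close>.\<close>
  have "set \<theta> = set \<theta>\<^sub>Q \<union> set \<theta>\<^sub>P"
    using fw_let.hyps(1-3) by (auto simp: enumerates_def FVp_def)
  then have "wl ?J = wl (App (Var g) ?T)"
    using T(1) \<open>vtype w = TopT\<close> by (intro wl_Lam_with_pat) auto
  then have J: "wl ?J = 0" using T by simp
  \<comment> \<open>By freshness, the tuple pattern does not capture \<open>f\<close> or
    \<open>g\<close>.\<close>
  have fg: "f \<in> FV ?J" "g \<in> FV ?J"
    using T fw_let.hyps by (auto simp: FVp_with_pat)
  have "wl ?N = wl (TensI (BangI (Var y)) (Sec ?J))"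
    using fg by (intro wl_Lam_unerased) auto
  then have N: "wl ?N = 0" using J by (simp del: wl.simps(3))
  have "f \<in> FV ?N" using fg fw_let.hyps by (auto simp: FVp_def)
  \<comment> \<open>Here \<open>x\<close> is bound at a \<open>Bang\<close> type, of workload 0, and
    \<open>f\<close> is used inside \<open>?N\<close>.\<close>
  then have "wl (Lam (PTens (PBang x) (PSec (PVar f))) (App ?N P')) = wl (App ?N P')"
    by (intro wl_Lam_unerased) auto
  then show ?case
    using N fw_let.IH by (simp add: wl_Lam_PBang algebra_simps del: wl.simps(3))
qed (auto intro!: sum.neutral)

text \<open>Bangs in a transform enclose only variables, constants and \<open>UnitI\<close>, all of
  workload 0, and \<open>Sec\<close> pairs share nothing since \<open>UnitI\<close> is closed. What
  remains is groundness in sums and tangent tuples.\<close>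

lemma safe_forward:
  assumes "forward S \<theta> P M" and "signature S b" and "prim_tm S P"
  shows "safe M"
  using assms(1,3)
proof (induction rule: forward.induct)
  case (fw_fn xs f \<theta> ys u w)
  have n: "1 \<le> arity S f" using assms(2) by (auto simp: signature_def)
  have "set \<theta> = set xs" using fw_fn.hyps by (metis enumerates_def FV_fn_call)
  then have "ground_ty (vtype (u x))" if "x \<in> set xs" for x
    using that fw_fn.hyps fw_fn.prems prim_tm_FV ground_tan_ty by (metis FV_fn_call)
  moreover have "ground_ty (vtype (ys ! i))" if "i < arity S f" for i
    using that fw_fn.hyps by (metis ground_ty.simps(1) nth_mem)
  ultimately have "safe (sum_tm (map (\<lambda>i. Mul (Var (ys ! i)) (Var (u (xs ! i)))) [0..<arity S f]))"
    using n fw_fn.hyps by (intro safe_sum_tm) auto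
  then show ?case
    by (intro safe_foldr_LetI) (simp_all add: safe_tens_tm)
next
  case (fw_let \<theta> x Q P \<theta>\<^sub>Q \<theta>\<^sub>P Q' P' D E y f g u w)
  have "ground_ty (vtype (u z))" if "z \<in> set \<theta>" for z
    using that fw_let.hyps fw_let.prems prim_tm_FV ground_tan_ty
    by (metis enumerates_def)
  then have u: "\<forall>z \<in> set \<theta>\<^sub>Q \<union> set \<theta>\<^sub>P. ground_ty (vtype (u z))"
    using fw_let.hyps by auto
  then have "safe (with_tm (map (\<lambda>z. Var (u z)) \<theta>\<^sub>Q))"
    by (intro safe_with_tm) (cases \<theta>\<^sub>Q; auto)+
  \<comment> \<open>The variable \<open>f\<close> has a \<open>Lolli\<close> type, but it sits in
    the first component; the later ones are ground tangents.\<close>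
  then have "safe (with_tm (App (Var f) (with_tm (map (\<lambda>z. Var (u z)) \<theta>\<^sub>Q))
      # map (\<lambda>z. Var (u z)) \<theta>\<^sub>P))"
    using u by (intro safe_with_tm) auto
  then show ?case using fw_let.IH prim_tm_LetI[OF fw_let.prems] by simp
qed simp_all

theorem theorem5p3:
  fixes S :: "'f sig" and b :: nat
  assumes "signature S b"
  shows "\<exists>c :: nat. \<forall>P \<theta> M.
    P \<in> lamLLp S \<longrightarrow> enumerates \<theta> P \<longrightarrow> forward S \<theta> P M \<longrightarrow>
      wl M \<le> c * wl P \<and> (safe P \<longrightarrow> safe M)"
  using wl_forward[OF _ assms] safe_forward[OF _ assms] by (auto simp: lamLLp_def)

end
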